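(* Let $T=(V,E)$ be a tree and let $G=(V,A)$ be the corresponding symmetric directed graph (with both $(u,v)$ and $(v,u)$ in $A$ for each $\{u,v\}\in E$), with arc weights, and let $C\subseteq F\subseteq V$. Consider the procedure: (1) while the current tree contains a leaf vertex that is not in $C$, delete it; (2) return the set $F^*$ of leaves of the resulting residual tree. Then $F^*$ is an optimum (minimum-size) pathwise-disjoint cover for $C$.
   Context: For $c\in C$, $f\in F$, $P(c,f)$ is the set of shortest directed paths from $c$ to $f$ in $G$ (in a tree, the unique simple path). A pair $\{f_1,f_2\}\subseteq F\setminus\{c\}$ covers $c$ in a pathwise-disjoint fashion if there are $p_1\in P(c,f_1)$, $p_2\in P(c,f_2)$ having no common vertex except $c$. A set $F'\subseteq F$ is a pathwise-disjoint cover for $C$ if every $c\in C\setminus F'$ is covered in a pathwise-disjoint fashion by some pair $\{f_1,f_2\}\subseteq F'\setminus\{c\}$ (a customer in $F'$ covers itself). *)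

theory Defs
  imports "Graph_Theory.Digraph_Component" "Graph_Theory.Weighted_Graph"
begin

definition symmetric_digraph_of :: "'a set \<Rightarrow> 'a set set \<Rightarrow> ('a, 'a \<times> 'a) pre_digraph" where
  "symmetric_digraph_of V E = with_proj \<lparr> pverts = V, parcs = {(u, v). {u, v} \<in> E} \<rparr>"

text \<open>
  The library's \<^const>\<open>tree\<close> only excludes directed cycles, so no symmetric digraph with an
  arc satisfies it. Here (V, E) is a finite simple undirected graph. In the symmetric digraph,
  going along an edge and back is a directed cycle of length 2; undirected cycles are
  exactly the directed ones of length at least 3. Nonemptiness of V is part of
  \<^const>\<open>strongly_connected\<close>.
\<close>

definition undirected_tree :: "'a set \<Rightarrow> 'a set set \<Rightarrow> bool" where
  "undirected_tree V E \<longleftrightarrow>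
     finite V \<and> (\<forall>e\<in>E. e \<subseteq> V \<and> card e = 2) \<and>
     strongly_connected (symmetric_digraph_of V E) \<and>
     \<not> (\<exists>p. pre_digraph.cycle (symmetric_digraph_of V E) p \<and> 3 \<le> length p)"

text \<open>
  Paths are simple, so no sign condition on the weights is needed for this to be meaningful.
\<close>

definition shortest_paths ::
    "('a, 'b) pre_digraph \<Rightarrow> 'b weight_fun \<Rightarrow> 'a \<Rightarrow> 'a \<Rightarrow> 'b awalk set" where
  "shortest_paths G w c f =
     {p. pre_digraph.apath G c p f \<and>
         (\<forall>q. pre_digraph.apath G c q f \<longrightarrow>
              wf_digraph.awalk_cost w p \<le> wf_digraph.awalk_cost w q)}"

text \<open>
  The condition on the paths forces f1 and f2 to be distinct, as each lies on its own path.
\<close>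

definition covers_pathwise_disjoint ::
    "('a, 'b) pre_digraph \<Rightarrow> 'b weight_fun \<Rightarrow> 'a \<Rightarrow> 'a \<Rightarrow> 'a \<Rightarrow> bool" where
  "covers_pathwise_disjoint G w c f1 f2 \<longleftrightarrow>
     f1 \<noteq> c \<and> f2 \<noteq> c \<and>
     (\<exists>p1\<in>shortest_paths G w c f1. \<exists>p2\<in>shortest_paths G w c f2.
        set (pre_digraph.awalk_verts G c p1) \<inter> set (pre_digraph.awalk_verts G c p2) = {c})"

definition pathwise_disjoint_cover ::
    "('a, 'b) pre_digraph \<Rightarrow> 'b weight_fun \<Rightarrow> 'a set \<Rightarrow> 'a set \<Rightarrow> 'a set \<Rightarrow> bool" where
  "pathwise_disjoint_cover G w C F F' \<longleftrightarrow>
     F' \<subseteq> F \<and>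
     (\<forall>c\<in>C - F'. \<exists>f1\<in>F' - {c}. \<exists>f2\<in>F' - {c}. covers_pathwise_disjoint G w c f1 f2)"

definition optimum_pathwise_disjoint_cover ::
    "('a, 'b) pre_digraph \<Rightarrow> 'b weight_fun \<Rightarrow> 'a set \<Rightarrow> 'a set \<Rightarrow> 'a set \<Rightarrow> bool" where
  "optimum_pathwise_disjoint_cover G w C F F' \<longleftrightarrow>
     pathwise_disjoint_cover G w C F F' \<and>
     (\<forall>F''. pathwise_disjoint_cover G w C F F'' \<longrightarrow> card F' \<le> card F'')"

text \<open>
  The single vertex of a one-vertex tree counts as a leaf: with one customer, pruning ends in
  the tree consisting of just that customer, and the customer must be returned.
\<close>

definition leaves :: "'a set \<Rightarrow> 'a set set \<Rightarrow> 'a set" where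
  "leaves V E = {v \<in> V. card {e \<in> E. v \<in> e} \<le> 1}"

inductive prune_step :: "'a set \<Rightarrow> 'a set \<times> 'a set set \<Rightarrow> 'a set \<times> 'a set set \<Rightarrow> bool"
  for C where
  "v \<in> leaves V E \<Longrightarrow> v \<notin> C \<Longrightarrow> prune_step C (V, E) (V - {v}, {e \<in> E. v \<notin> e})"

text \<open>
  The procedure may choose which leaf to delete, so its result is a relation: some run that
  starts from (V, E) stops, when no leaf outside C is left, with leaf set S.
\<close>

definition leaf_pruning_returns :: "'a set \<Rightarrow> 'a set set \<Rightarrow> 'a set \<Rightarrow> 'a set \<Rightarrow> bool" where
  "leaf_pruning_returns V E C S \<longleftrightarrow>
     (\<exists>V' E'. (prune_step C)\<^sup>*\<^sup>* (V, E) (V', E') \<and>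
              \<not> (\<exists>v\<in>leaves V' E'. v \<notin> C) \<and> S = leaves V' E')"

end

theory Submission
  imports Defs
begin

text \<open>
  Pruning maintains a map r on vertices that fixes the residual tree and contracts every edge that
  is not an edge of the residual tree. A path leaving the fibre of a residual leaf l under r has to
  run through the unique residual neighbour of l, so two paths from l that meet only in l cannot
  both leave it. Hence every cover meets the fibre of every residual leaf, and these fibres are
  disjoint. Conversely, a customer of residual degree at least 2 starts two paths in different
  directions; extended maximally they end in residual leaves, and without cycles they are
  disjoint and are the only paths to their ends, whatever the weights.
\<close>

section \<open>Simple paths and cycles as vertex lists\<close>

abbreviation edge_walk :: "'a set set \<Rightarrow> 'a list \<Rightarrow> bool" where
  "edge_walk E \<equiv> successively (\<lambda>x y. {x, y} \<in> E)"

definition simple_path :: "'a set set \<Rightarrow> 'a list \<Rightarrow> bool" where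
  "simple_path E xs \<longleftrightarrow> xs \<noteq> [] \<and> distinct xs \<and> edge_walk E xs"

text \<open>The starting vertex is not repeated at the end; the closing edge is stated separately.
  The bound 3 excludes going along one edge and back.\<close>

definition has_edge_cycle :: "'a set set \<Rightarrow> bool" where
  "has_edge_cycle E \<longleftrightarrow> (\<exists>xs. simple_path E xs \<and> 3 \<le> length xs \<and> {last xs, hd xs} \<in> E)"

lemma edge_walk_rev: "edge_walk E (rev xs) = edge_walk E xs"
  by (simp add: successively_rev insert_commute)

lemma simple_path_mono: "simple_path E xs \<Longrightarrow> E \<subseteq> E' \<Longrightarrow> simple_path E' xs"
  unfolding simple_path_def by (auto elim: successively_mono)

lemma has_edge_cycle_mono: "has_edge_cycle E \<Longrightarrow> E \<subseteq> E' \<Longrightarrow> has_edge_cycle E'"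
  unfolding has_edge_cycle_def using simple_path_mono by blast

lemma successively_crossing:
  assumes "successively R xs" "xs \<noteq> []" "P (hd xs)" "\<not> P (last xs)"
  shows "\<exists>x\<in>set xs. \<exists>y\<in>set xs. R x y \<and> P x \<and> \<not> P y"
  using assms by (induction xs rule: induct_list012) (auto split: if_splits)

text \<open>If the two paths met again, the first vertex of the second path that lies on the first
  one would close a cycle through \<open>c\<close>.\<close>

lemma diverging_paths_disjoint:
  assumes acyc: "\<not> has_edge_cycle E"
    and p: "simple_path E (c # a # xs)" and q: "simple_path E (c # b # ys)" and "a \<noteq> b"
  shows "set (a # xs) \<inter> set (b # ys) = {}"
proof (rule ccontr)
  assume "set (a # xs) \<inter> set (b # ys) \<noteq> {}"
  then have "\<exists>z\<in>set (b # ys). z \<in> set (a # xs)" by blast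
  then obtain ys1 z ys2 where ys: "b # ys = ys1 @ z # ys2" and z: "z \<in> set (a # xs)"
    and ys1: "\<forall>y\<in>set ys1. y \<notin> set (a # xs)"
    by (rule split_list_first_propE)
  obtain xs1 xs2 where xs: "a # xs = xs1 @ z # xs2"
    using split_list[OF z] by blast
  \<comment> \<open>The candidate cycle runs from \<open>c\<close> along the first path to
    \<open>z\<close> and back along the second path to \<open>b\<close>, whose edge to
    \<open>c\<close> closes it.\<close>
  let ?zs = "c # xs1 @ z # rev ys1"
  have p': "distinct (c # xs1 @ z # xs2)" "edge_walk E (c # xs1 @ z # xs2)"
    and q': "distinct (c # ys1 @ z # ys2)" "edge_walk E (c # ys1 @ z # ys2)"
    using p q xs ys by (simp_all add: simple_path_def)
  have w1: "edge_walk E ((c # xs1) @ [z])"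
    using p'(2) successively_append_iff[of _ "(c # xs1) @ [z]" xs2] by simp
  have "edge_walk E (ys1 @ [z])"
    using q'(2) successively_append_iff[of _ "c # ys1 @ [z]" ys2]
    by (auto simp: successively_Cons)
  then have w2: "edge_walk E (z # rev ys1)"
    using edge_walk_rev[of E "ys1 @ [z]"] by simp
  have "edge_walk E ?zs"
    using w1 w2 successively_append_iff[of _ "c # xs1" "z # rev ys1"]
      successively_append_iff[of _ "c # xs1" "[z]"] by simp
  moreover have "distinct ?zs"
    using p'(1) q'(1) ys1 xs by auto
  moreover have "last ?zs = b"
    using ys by (cases ys1) auto
  then have "{last ?zs, hd ?zs} \<in> E"
    using q by (simp add: simple_path_def insert_commute)
  \<comment> \<open>If \<open>xs1\<close> and \<open>ys1\<close> were both empty, then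
    \<open>a = z = b\<close>.\<close>
  moreover have "3 \<le> length ?zs"
    using xs ys \<open>a \<noteq> b\<close> by (cases xs1; cases ys1) auto
  ultimately have "has_edge_cycle E"
    unfolding has_edge_cycle_def simple_path_def by blast
  then show False using acyc by simp
qed

text \<open>The common last vertex lies on both paths, so by \<open>diverging_paths_disjoint\<close>
  their first steps must agree; induction does the rest.\<close>

lemma simple_path_unique:
  assumes acyc: "\<not> has_edge_cycle E"
    and "simple_path E xs" "simple_path E ys" "hd xs = hd ys" "last xs = last ys"
  shows "xs = ys"
  using assms(2-)
proof (induction xs arbitrary: ys)
  case Nil
  then show ?case by (simp add: simple_path_def)
next
  case (Cons c xs)
  then obtain ys' where ys: "ys = c # ys'"
    by (cases ys) (auto simp: simple_path_def)
  show ?case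
  proof (cases "xs = [] \<or> ys' = []")
    case True
    then show ?thesis
      using Cons.prems ys by (auto simp: simple_path_def split: if_splits)
  next
    case False
    then obtain a xs1 b ys1 where eq: "xs = a # xs1" "ys' = b # ys1"
      by (meson list.exhaust)
    have "last xs \<in> set (a # xs1) \<inter> set (b # ys1)"
      using Cons.prems(4) ys eq by (metis IntI last_ConsR last_in_set list.discI)
    then have "a = b"
      using diverging_paths_disjoint[OF acyc, of c a xs1 b ys1] Cons.prems ys eq by blast
    then have "xs = ys'"
      using Cons.prems ys eq by (intro Cons.IH) (auto simp: simple_path_def)
    then show ?thesis using ys by simp
  qed
qed

section \<open>Leaves and maximal paths\<close>

lemma leaf_neighbour_unique:
  assumes "v \<in> leaves V E" "finite E" "{v, x} \<in> E" "{v, y} \<in> E"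
  shows "x = y"
proof -
  \<comment> \<open>Finiteness matters here: \<open>card\<close> of an infinite set is 0, so the
    bound alone would say nothing.\<close>
  have "card {e \<in> E. v \<in> e} \<le> Suc 0" "finite {e \<in> E. v \<in> e}"
    using assms by (auto simp: leaves_def)
  then have "{v, x} = {v, y}"
    using assms(3,4) card_le_Suc0_iff_eq by fastforce
  then show ?thesis by (auto simp: doubleton_eq_iff)
qed

text \<open>The vertex \<open>u\<close> is arbitrary, so this yields a first neighbour as well as
  one avoiding a given neighbour.\<close>

lemma non_leaf_second_neighbour:
  assumes "v \<in> V" "v \<notin> leaves V E" "\<forall>e\<in>E. card e = 2"
  obtains x where "{v, x} \<in> E" "x \<noteq> u"
proof -
  have "\<not> {e \<in> E. v \<in> e} \<subseteq> {{v, u}}"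
    using assms(1,2) card_mono[of "{{v, u}}" "{e \<in> E. v \<in> e}"] by (auto simp: leaves_def)
  then obtain e where e: "e \<in> E" "v \<in> e" "e \<noteq> {v, u}" by blast
  then obtain x where "e = {v, x}"
    using assms(3) by (metis card_2_iff insert_iff insert_commute singletonD)
  then show ?thesis using e that by blast
qed

text \<open>A longest simple path with the prescribed first edge exists, as \<open>V\<close> is
  finite. If its end were not a leaf, a further neighbour of the end would either prolong the path
  or close a cycle.\<close>

lemma path_extends_to_leaf:
  assumes acyc: "\<not> has_edge_cycle E" and fin: "finite V"
    and E: "\<forall>e\<in>E. e \<subseteq> V \<and> card e = 2" and ca: "{c, a} \<in> E"
  shows "\<exists>xs. simple_path E (c # a # xs) \<and> last (c # a # xs) \<in> leaves V E"
proof -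
  let ?P = "\<lambda>xs. simple_path E (c # a # xs)"
  have verts: "set xs \<subseteq> V" if "?P xs" for xs
  proof -
    have "set xs \<subseteq> V" if "edge_walk E (x # xs)" for x
      using that E by (induction xs arbitrary: x) (auto simp: successively_Cons)
    from this[of a] show ?thesis using that by (auto simp: simple_path_def)
  qed
  have "c \<noteq> a" using E ca by fastforce
  then have "?P []" using ca by (simp add: simple_path_def)
  moreover have "length xs < Suc (card V)" if "?P xs" for xs
    using verts[OF that] that fin
    by (metis card_mono distinct.simps(2) distinct_card le_imp_less_Suc simple_path_def)
  ultimately have "\<exists>xs. ?P xs \<and> (\<forall>ys. ?P ys \<longrightarrow> length ys \<le> length xs)"
    by (intro ex_has_greatest_nat[of ?P "[]" length "Suc (card V)"] allI impI)
  then obtain xs where xs: "?P xs" and longest: "\<And>ys. ?P ys \<Longrightarrow> length ys \<le> length xs"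
    by (elim exE conjE) simp
  obtain ys z where ys: "a # xs = ys @ [z]"
    by (cases "a # xs" rule: rev_cases) auto
  obtain ws y where "c # ys = ws @ [y]"
    by (cases "c # ys" rule: rev_cases) auto
  then have path: "c # a # xs = ws @ [y, z]"
    using ys by simp
  then have z_def: "z = last (c # a # xs)"
    by (simp only: last_append) simp
  have "z \<in> leaves V E"
  proof (rule ccontr)
    assume nl: "z \<notin> leaves V E"
    have "z \<in> V"
      using verts[OF xs] E ca unfolding z_def by (auto split: if_splits)
    then obtain t where t: "{z, t} \<in> E" "t \<noteq> y"
      using nl E non_leaf_second_neighbour[of z V E] by metis
    have "t \<noteq> z" using t(1) E by fastforce
    show False
    proof (cases "t \<in> set (c # a # xs)")
      case True
      then have "t \<in> set ws" using path t \<open>t \<noteq> z\<close> by auto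
      then obtain us vs where ws: "ws = us @ t # vs" by (meson split_list)
      \<comment> \<open>Since \<open>t\<close> differs from \<open>y\<close> and \<open>z\<close>,
        it lies in \<open>ws\<close>; the segment from \<open>t\<close> to \<open>z\<close> has at
        least three vertices even if \<open>vs\<close> is empty.\<close>
      have "simple_path E (t # vs @ [y, z])"
        using xs unfolding simple_path_def path ws by (simp add: successively_append_iff)
      then have "has_edge_cycle E"
        unfolding has_edge_cycle_def using t(1) by (intro exI[of _ "t # vs @ [y, z]"]) simp
      then show False using acyc by simp
    next
      case False
      moreover have "edge_walk E ((c # a # xs) @ [t])"
        using xs t(1) unfolding successively_append_iff z_def by (simp add: simple_path_def)
      ultimately have "?P (xs @ [t])"
        using xs by (auto simp: simple_path_def)
      from longest[OF this] show False by simp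
    qed
  qed
  then show ?thesis using xs z_def by blast
qed

section \<open>Translation between vertex lists and arc walks\<close>

lemma symmetric_digraph_of_simps [simp]:
  "verts (symmetric_digraph_of V E) = V"
  "arcs (symmetric_digraph_of V E) = {(u, v). {u, v} \<in> E}"
  "tail (symmetric_digraph_of V E) = fst"
  "head (symmetric_digraph_of V E) = snd"
  by (simp_all add: symmetric_digraph_of_def)

lemma wf_symmetric_digraph_of:
  "\<forall>e\<in>E. e \<subseteq> V \<Longrightarrow> wf_digraph (symmetric_digraph_of V E)"
  by unfold_locales auto

context
  fixes V :: "'a set" and E :: "'a set set"
  assumes E: "\<forall>e\<in>E. e \<subseteq> V"
begin

interpretation G: wf_digraph "symmetric_digraph_of V E"
  using E by (rule wf_symmetric_digraph_of)

text \<open>Arcs are pairs of vertices, so \<open>zip xs (tl xs)\<close> lists the arcs between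
  consecutive vertices. For a one-vertex list it is empty, and \<open>hd xs \<in> V\<close> is what
  makes the empty list a walk.\<close>

lemma awalk_of_edge_walk:
  assumes "edge_walk E xs" "xs \<noteq> []" "hd xs \<in> V"
  shows "G.awalk (hd xs) (zip xs (tl xs)) (last xs)"
    and "G.awalk_verts (hd xs) (zip xs (tl xs)) = xs"
  using assms
proof (induction xs rule: induct_list012)
  case (3 x y zs)
  { case 1 with 3 E show ?case by (auto simp: G.awalk_Cons_iff) }
  { case 2 with 3 E show ?case by auto }
qed (auto simp: G.awalk_def)

text \<open>The second fact recovers a walk from its vertices; it carries uniqueness of vertex lists
  over to arc lists.\<close>

lemma edge_walk_of_awalk:
  assumes "G.awalk u p v"
  shows "edge_walk E (G.awalk_verts u p)"
    and "p = zip (G.awalk_verts u p) (tl (G.awalk_verts u p))"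
    and "hd (G.awalk_verts u p) = u" and "last (G.awalk_verts u p) = v"
proof -
  have "edge_walk E (G.awalk_verts u p)
    \<and> p = zip (G.awalk_verts u p) (tl (G.awalk_verts u p)) \<and> hd (G.awalk_verts u p) = u"
    using assms
  proof (induction p arbitrary: u)
    case (Cons e es)
    then have *: "G.awalk (snd e) es v" "fst e = u" "{fst e, snd e} \<in> E"
      by (auto simp: G.awalk_Cons_iff)
    obtain ys where "G.awalk_verts (snd e) es = snd e # ys"
      using Cons.IH[OF *(1)] by (metis G.awalk_verts_non_Nil list.collapse)
    then show ?case using Cons.IH[OF *(1)] * by auto
  qed simp
  then show "edge_walk E (G.awalk_verts u p)"
    "p = zip (G.awalk_verts u p) (tl (G.awalk_verts u p))"
    "hd (G.awalk_verts u p) = u" by blast+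
  show "last (G.awalk_verts u p) = v"
    using assms by (auto elim: G.awalkE)
qed

text \<open>Without cycles this is the only \<open>apath\<close> between its ends, so its cost is
  minimal for every \<open>w\<close>.\<close>

lemma simple_path_in_shortest_paths:
  assumes acyc: "\<not> has_edge_cycle E" and xs: "simple_path E xs" "hd xs \<in> V"
  shows "zip xs (tl xs) \<in> shortest_paths (symmetric_digraph_of V E) w (hd xs) (last xs)"
proof -
  have ne: "edge_walk E xs" "xs \<noteq> []" "distinct xs" using xs by (auto simp: simple_path_def)
  have "q = zip xs (tl xs)" if "G.apath (hd xs) q (last xs)" for q
  proof -
    have aw: "G.awalk (hd xs) q (last xs)" using that by (simp add: G.apath_def)
    have "simple_path E (G.awalk_verts (hd xs) q)"
      using that edge_walk_of_awalk[OF aw] by (simp add: simple_path_def G.apath_def)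
    then have "G.awalk_verts (hd xs) q = xs"
      using simple_path_unique[OF acyc _ xs(1)] edge_walk_of_awalk[OF aw] by blast
    then show ?thesis using edge_walk_of_awalk(2)[OF aw] by simp
  qed
  then show ?thesis
    using awalk_of_edge_walk[OF ne(1,2) xs(2)] ne(3)
    by (auto simp: shortest_paths_def G.apath_def)
qed

lemma cycle_of_edge_cycle:
  assumes "has_edge_cycle E"
  shows "\<exists>p. G.cycle p \<and> 3 \<le> length p"
proof -
  obtain xs where xs: "simple_path E xs" "3 \<le> length xs" "{last xs, hd xs} \<in> E"
    using assms by (auto simp: has_edge_cycle_def)
  let ?ys = "xs @ [hd xs]"
  have ne: "xs \<noteq> []" "distinct xs" using xs by (auto simp: simple_path_def)
  have "edge_walk E ?ys" "hd ?ys \<in> V"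
    using xs E by (auto simp: simple_path_def successively_append_iff)
  from awalk_of_edge_walk[OF this(1) _ this(2)] ne
  have aw: "G.awalk (hd xs) (zip ?ys (tl ?ys)) (hd xs)"
    and av: "G.awalk_verts (hd xs) (zip ?ys (tl ?ys)) = ?ys" by auto
  have "distinct (tl ?ys)" using ne by (cases xs) auto
  moreover have "length (zip ?ys (tl ?ys)) = length xs" by simp
  ultimately show ?thesis
    using aw av xs(2) unfolding G.cycle_def by (metis list.size(3) not_numeral_le_zero)
qed

end

section \<open>Contractions onto the residual tree\<close>

text \<open>The fibre of a residual vertex contains the vertex itself and no other residual vertex.
  Values outside \<open>V'\<close> are allowed, so that \<open>V'\<close> may be empty, which
  happens when pruning without customers.\<close>

definition contracts_onto :: "'a set set \<Rightarrow> 'a set \<Rightarrow> ('a \<Rightarrow> 'a) \<Rightarrow> bool" where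
  "contracts_onto E V' r \<longleftrightarrow>
     (\<forall>x\<in>V'. r x = x) \<and> (\<forall>x y. {x, y} \<in> E \<longrightarrow> r x = r y \<or> x \<in> V' \<and> y \<in> V')"

text \<open>The edge on which the walk leaves the fibre of \<open>v\<close> is not contracted, so
  both its ends are residual and fixed by \<open>r\<close>; hence its inner end is \<open>v\<close>
  itself.\<close>

lemma walk_leaving_fibre:
  assumes r: "contracts_onto E V' r" and v: "v \<in> V'"
    and xs: "edge_walk E xs" "xs \<noteq> []" "hd xs = v" "r (last xs) \<noteq> v"
  shows "\<exists>y\<in>set xs. y \<noteq> v \<and> y \<in> V' \<and> {v, y} \<in> E"
proof -
  have "r (hd xs) = v" using r v xs(3) by (simp add: contracts_onto_def)
  then obtain x y where xy: "y \<in> set xs" "{x, y} \<in> E" "r x = v" "r y \<noteq> v"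
    using successively_crossing[OF xs(1,2), of "\<lambda>x. r x = v"] xs(4) by blast
  then have "r x \<noteq> r y" by simp
  then have "x \<in> V'" "y \<in> V'" "r x = x" "r y = y"
    using r xy(2) unfolding contracts_onto_def by blast+
  then show ?thesis using xy by auto
qed

text \<open>The fibre of the deleted leaf \<open>v\<close> is merged into that of its only residual
  neighbour \<open>u\<close>, which contracts the edge between them.\<close>

lemma contracts_onto_remove_leaf:
  assumes r: "contracts_onto E V' r"
    and u: "\<And>y. y \<in> V' \<Longrightarrow> {v, y} \<in> E \<Longrightarrow> y = u" and "u \<in> V'" "u \<noteq> v"
  shows "contracts_onto E (V' - {v}) (\<lambda>x. if r x = v then u else r x)"
proof -
  have "r' x = r' y \<or> x \<in> V' - {v} \<and> y \<in> V' - {v}"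
    if xy: "{x, y} \<in> E" and r': "r' = (\<lambda>x. if r x = v then u else r x)" for x y r'
  proof (cases "r x = r y")
    case True
    then show ?thesis using r' by simp
  next
    case False
    then have V': "x \<in> V'" "y \<in> V'" and fixed: "r x = x" "r y = y"
      using r xy unfolding contracts_onto_def by metis+
    consider "x = v" "y = u" | "y = v" "x = u" | "x \<noteq> v" "y \<noteq> v"
      using u[of x] u[of y] xy V' by (metis insert_commute)
    then show ?thesis using r' V' fixed by cases auto
  qed
  then show ?thesis using r unfolding contracts_onto_def by simp
qed

section \<open>The pruning invariant, feasibility and optimality\<close>

locale finite_tree =
  fixes V :: "'a set" and E :: "'a set set"
  assumes tree: "undirected_tree V E"
begin

lemma finite_V: "finite V"
  and edges: "\<forall>e\<in>E. e \<subseteq> V \<and> card e = 2"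
  and edges_subset: "\<forall>e\<in>E. e \<subseteq> V"
  and finite_E: "finite E"
  using tree by (auto simp: undirected_tree_def intro: finite_subset[of E "Pow V"])

sublocale G: wf_digraph "symmetric_digraph_of V E"
  using edges_subset by (rule wf_symmetric_digraph_of)

lemma acyclic: "\<not> has_edge_cycle E"
  using tree cycle_of_edge_cycle[OF edges_subset] by (auto simp: undirected_tree_def)

lemma ex_edge_walk:
  assumes "u \<in> V" "v \<in> V"
  shows "\<exists>xs. edge_walk E xs \<and> xs \<noteq> [] \<and> hd xs = u \<and> last xs = v"
proof -
  have "u \<rightarrow>\<^sup>*\<^bsub>symmetric_digraph_of V E\<^esub> v"
    using tree assms by (auto simp: undirected_tree_def strongly_connected_def)
  then obtain p where "G.awalk u p v"
    using G.reachable_awalk by blast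
  from edge_walk_of_awalk[OF edges_subset this] show ?thesis
    using G.awalk_verts_non_Nil by blast
qed

text \<open>Invariant of the pruning steps. The contraction stands in for connectedness of the
  residual tree: it turns walks of the original tree into residual neighbours.\<close>

definition residual :: "'a set \<Rightarrow> 'a set \<times> 'a set set \<Rightarrow> bool" where
  "residual C T \<longleftrightarrow> C \<subseteq> fst T \<and> fst T \<subseteq> V \<and> snd T = {e \<in> E. e \<subseteq> fst T} \<and>
     (\<exists>r. contracts_onto E (fst T) r)"

lemma residual_start: "C \<subseteq> V \<Longrightarrow> residual C (V, E)"
  unfolding residual_def contracts_onto_def using edges
  by (auto intro!: exI[of _ "\<lambda>x. x"])

lemma residual_step:
  assumes "prune_step C T T'" "residual C T"
  shows "residual C T'"
  using assms
proof cases
  case (1 v V' E')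
  then obtain r where V': "C \<subseteq> V'" "V' \<subseteq> V" and E': "E' = {e \<in> E. e \<subseteq> V'}"
    and r: "contracts_onto E V' r"
    using assms(2) by (auto simp: residual_def)
  have v: "v \<in> V'" using 1 by (simp add: leaves_def)
  have "\<exists>r'. contracts_onto E (V' - {v}) r'"
  proof (cases "V' = {v}")
    case True
    \<comment> \<open>The last vertex is deleted; any constant map contracts every edge.\<close>
    then show ?thesis by (auto simp: contracts_onto_def)
  next
    case False
    then obtain x where x: "x \<in> V'" "x \<noteq> v" using v by blast
    then obtain xs where xs: "edge_walk E xs" "xs \<noteq> []" "hd xs = v" "last xs = x"
      using ex_edge_walk v V' by blast
    moreover have "r x \<noteq> v" using r x by (simp add: contracts_onto_def)
    \<comment> \<open>The walk to another residual vertex \<open>x\<close> leaves the fibre of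
      \<open>v\<close>, so it passes a residual neighbour of \<open>v\<close>.\<close>
    ultimately obtain u where u: "u \<noteq> v" "u \<in> V'" "{v, u} \<in> E"
      using walk_leaving_fibre[OF r v] by blast
    have "y = u" if "y \<in> V'" "{v, y} \<in> E" for y
      using leaf_neighbour_unique[of v V' E' y u] 1 that u v E' finite_E by auto
    then show ?thesis
      using contracts_onto_remove_leaf[OF r _ u(2,1)] by blast
  qed
  moreover have "{e \<in> E'. v \<notin> e} = {e \<in> E. e \<subseteq> V' - {v}}" using E' by auto
  ultimately show ?thesis
    using 1 V' by (auto simp: residual_def)
qed

lemma residual_steps:
  assumes "(prune_step C)\<^sup>*\<^sup>* T T'" "residual C T"
  shows "residual C T'"
  using assms by induction (auto intro: residual_step)

text \<open>A customer \<open>c\<close> that is not a residual leaf has two residual neighbours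
  \<open>a\<close> and \<open>b\<close>. Paths through them that end in residual leaves diverge at
  \<open>c\<close>, so they meet only there.\<close>

lemma pruning_covers:
  assumes "residual C (V', E')" "leaves V' E' \<subseteq> F"
  shows "pathwise_disjoint_cover (symmetric_digraph_of V E) w C F (leaves V' E')"
  unfolding pathwise_disjoint_cover_def
proof (intro conjI ballI)
  fix c assume c: "c \<in> C - leaves V' E'"
  have V': "c \<in> V'" "V' \<subseteq> V" and E': "E' = {e \<in> E. e \<subseteq> V'}"
    using assms(1) c by (auto simp: residual_def)
  have acyc: "\<not> has_edge_cycle E'"
    using acyclic has_edge_cycle_mono[of E' E] E' by blast
  have edges': "\<forall>e\<in>E'. e \<subseteq> V' \<and> card e = 2" "E' \<subseteq> E" using E' edges by auto
  have fin: "finite V'" using V' finite_V finite_subset by blast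
  obtain a where a: "{c, a} \<in> E'"
    by (rule non_leaf_second_neighbour[of c V' E']) (use V' c edges' in auto)
  obtain b where b: "{c, b} \<in> E'" "b \<noteq> a"
    by (rule non_leaf_second_neighbour[of c V' E' a]) (use V' c edges' in auto)
  have path: "\<exists>f p. f \<in> leaves V' E' \<and> f \<noteq> c \<and> p \<in> shortest_paths (symmetric_digraph_of V E) w c f
      \<and> (\<exists>xs. simple_path E (c # d # xs) \<and> G.awalk_verts c p = c # d # xs)"
    if d: "{c, d} \<in> E'" for d
  proof -
    obtain xs where xs: "simple_path E' (c # d # xs)" "last (c # d # xs) \<in> leaves V' E'"
      using path_extends_to_leaf[OF acyc fin edges'(1) d] by blast
    let ?ys = "c # d # xs"
    \<comment> \<open>The path is built in \<open>E'\<close>, so that it ends in a residual leaf,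
      but being shortest refers to the whole tree.\<close>
    have ys: "simple_path E ?ys" "hd ?ys \<in> V"
      using simple_path_mono[OF xs(1) edges'(2)] V' by auto
    have "G.awalk_verts c (zip ?ys (tl ?ys)) = ?ys"
      using ys awalk_of_edge_walk(2)[OF edges_subset, of ?ys] unfolding simple_path_def list.sel
      by blast
    moreover have "zip ?ys (tl ?ys) \<in> shortest_paths (symmetric_digraph_of V E) w c (last ?ys)"
      using simple_path_in_shortest_paths[OF edges_subset acyclic ys, of w] unfolding list.sel .
    moreover have "last ?ys \<noteq> c" using xs(2) c by (metis DiffD2)
    ultimately show ?thesis
      using ys(1) xs(2)
      by (intro exI[of _ "last ?ys"] exI[of _ "zip ?ys (tl ?ys)"] exI[of _ xs] conjI)
  qed
  obtain f p xs
    where f: "f \<in> leaves V' E'" "f \<noteq> c" "p \<in> shortest_paths (symmetric_digraph_of V E) w c f"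
      "simple_path E (c # a # xs)" "G.awalk_verts c p = c # a # xs"
    using path[OF a] by (elim exE conjE)
  obtain g q ys
    where g: "g \<in> leaves V' E'" "g \<noteq> c" "q \<in> shortest_paths (symmetric_digraph_of V E) w c g"
      "simple_path E (c # b # ys)" "G.awalk_verts c q = c # b # ys"
    using path[OF b(1)] by (elim exE conjE)
  have "set (a # xs) \<inter> set (b # ys) = {}"
    using diverging_paths_disjoint[OF acyclic f(4) g(4)] b by blast
  moreover have "c \<notin> set (a # xs)" "c \<notin> set (b # ys)"
    using f(4) g(4) by (auto simp: simple_path_def)
  ultimately have "set (G.awalk_verts c p) \<inter> set (G.awalk_verts c q) = {c}"
    unfolding f(5) g(5) by auto
  then have "covers_pathwise_disjoint (symmetric_digraph_of V E) w c f g"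
    unfolding covers_pathwise_disjoint_def using f g by blast
  then show "\<exists>f\<in>leaves V' E' - {c}. \<exists>g\<in>leaves V' E' - {c}.
      covers_pathwise_disjoint (symmetric_digraph_of V E) w c f g"
    using f g by blast
qed (use assms in blast)

text \<open>The image of any cover \<open>S\<close> under \<open>r\<close> contains all residual
  leaves, which bounds their number by \<open>card S\<close>.\<close>

lemma leaves_card_le_cover:
  assumes res: "residual C (V', E')" and leaves: "leaves V' E' \<subseteq> C" and "F \<subseteq> V"
    and cover: "pathwise_disjoint_cover (symmetric_digraph_of V E) w C F S"
  shows "card (leaves V' E') \<le> card S"
proof -
  obtain r where r: "contracts_onto E V' r" and V': "V' \<subseteq> V" and E': "E' = {e \<in> E. e \<subseteq> V'}"
    using res by (auto simp: residual_def)
  have "S \<subseteq> V" using cover \<open>F \<subseteq> V\<close> by (auto simp: pathwise_disjoint_cover_def)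
  then have "finite S" using finite_V finite_subset by blast
  moreover have "leaves V' E' \<subseteq> r ` S"
  proof
    fix l assume l: "l \<in> leaves V' E'"
    then have lV: "l \<in> V'" by (simp add: leaves_def)
    then have rl: "r l = l" using r by (simp add: contracts_onto_def)
    show "l \<in> r ` S"
    proof (cases "l \<in> S")
      case True
      then show ?thesis using rl by force
    next
      case False
      then obtain f g p q where fg: "f \<in> S" "g \<in> S"
        and p: "G.awalk l p f" and q: "G.awalk l q g"
        and disj: "set (G.awalk_verts l p) \<inter> set (G.awalk_verts l q) = {l}"
        using cover l leaves
        unfolding pathwise_disjoint_cover_def covers_pathwise_disjoint_def shortest_paths_def
          G.apath_def by blast
      \<comment> \<open>A walk from \<open>l\<close> to a vertex outside the fibre of
        \<open>l\<close> visits a residual neighbour of \<open>l\<close>; a leaf has only one, so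
        two walks meeting only in \<open>l\<close> cannot both do so.\<close>
      have out: "\<exists>y\<in>set (G.awalk_verts l p). y \<noteq> l \<and> {l, y} \<in> E'"
        if "G.awalk l p f" "r f \<noteq> l" for p f
      proof -
        have "\<exists>y\<in>set (G.awalk_verts l p). y \<noteq> l \<and> y \<in> V' \<and> {l, y} \<in> E"
          using edge_walk_of_awalk[OF edges_subset that(1)] that(2)
          by (intro walk_leaving_fibre[OF r lV]) auto
        then show ?thesis using lV E' by blast
      qed
      have "r f = l \<or> r g = l"
      proof (rule ccontr)
        assume "\<not> (r f = l \<or> r g = l)"
        then obtain x y where x: "x \<in> set (G.awalk_verts l p)" "x \<noteq> l" "{l, x} \<in> E'"
          and y: "y \<in> set (G.awalk_verts l q)" "y \<noteq> l" "{l, y} \<in> E'"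
          using out[OF p] out[OF q] by blast
        have "x = y"
          using leaf_neighbour_unique[OF l _ x(3) y(3)] E' finite_E by simp
        then show False using x y disj by blast
      qed
      then show ?thesis using fg by blast
    qed
  qed
  ultimately show ?thesis
    by (rule surj_card_le)
qed

end

section \<open>Termination and the final result\<close>

lemma pruning_terminates:
  assumes "finite V"
  shows "\<exists>S. leaf_pruning_returns V E C S"
  using assms
proof (induction "card V" arbitrary: V E rule: less_induct)
  case less
  show ?case
  proof (cases "\<exists>v\<in>leaves V E. v \<notin> C")
    case True
    then obtain v where v: "v \<in> leaves V E" "v \<notin> C" by blast
    then have "card (V - {v}) < card V"
      using less.prems by (intro psubset_card_mono) (auto simp: leaves_def)
    then obtain S where "leaf_pruning_returns (V - {v}) {e \<in> E. v \<notin> e} C S"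
      using less by blast
    moreover have "prune_step C (V, E) (V - {v}, {e \<in> E. v \<notin> e})"
      using v by (rule prune_step.intros)
    ultimately show ?thesis
      unfolding leaf_pruning_returns_def by (meson converse_rtranclp_into_rtranclp)
  next
    case False
    then show ?thesis unfolding leaf_pruning_returns_def by blast
  qed
qed

text \<open>The first conjunct keeps the second from holding vacuously; the second applies to every
  order in which leaves are deleted.\<close>

theorem theorem3:
  fixes V :: "'a set" and E :: "'a set set" and w :: "('a \<times> 'a) weight_fun"
    and C F :: "'a set"
  assumes "undirected_tree V E"
    and "C \<subseteq> F" and "F \<subseteq> V"
  shows "(\<exists>Fstar. leaf_pruning_returns V E C Fstar) \<and>
         (\<forall>Fstar. leaf_pruning_returns V E C Fstar \<longrightarrow>
            optimum_pathwise_disjoint_cover (symmetric_digraph_of V E) w C F Fstar)"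
proof (intro conjI allI impI)
  interpret finite_tree V E by standard (fact assms(1))
  show "\<exists>Fstar. leaf_pruning_returns V E C Fstar"
    using finite_V by (rule pruning_terminates)
  fix Fstar assume "leaf_pruning_returns V E C Fstar"
  then obtain V' E' where steps: "(prune_step C)\<^sup>*\<^sup>* (V, E) (V', E')"
    and leaves: "leaves V' E' \<subseteq> C" and Fstar: "Fstar = leaves V' E'"
    unfolding leaf_pruning_returns_def by blast
  have res: "residual C (V', E')"
    using residual_steps[OF steps residual_start] assms by blast
  have "leaves V' E' \<subseteq> F"
    using leaves assms(2) by blast
  then show "optimum_pathwise_disjoint_cover (symmetric_digraph_of V E) w C F Fstar"
    unfolding optimum_pathwise_disjoint_cover_def Fstar
    by (intro conjI allI impI pruning_covers[OF res]
        leaves_card_le_cover[OF res leaves assms(3)])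
qed

end
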